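(* Let $h$ and $h'$ be Hessenberg functions with $h>h'$. Then $I_h\subset I_{h'}$ (i.e., $I_h$ is contained in $I_{h'}$).
   Context: A Hessenberg function is an $n$-tuple $h=(h_1,\ldots,h_n)$ of integers with $i\le h_i\le n$ for all $i$ and $h_i\le h_{i+1}$ for $1\le i\le n-1$. Hessenberg functions are partially ordered by $h\le h'$ iff $h_i\le h'_i$ for all $i$; $h>h'$ means $h\ge h'$ and $h\ne h'$. For $S\subseteq\{1,\ldots,n\}$, $e_d(S)$ denotes the sum of all squarefree monomials $x_{i_1}\cdots x_{i_d}$ with $i_1<\cdots<i_d$ in $S$ (with $e_0(S)=1$, $e_d(S)=0$ for $d<0$ or $d>|S|$), and $e_d(1,\ldots,m)$ means $S=\{1,\ldots,m\}$. $I_h$ is the ideal of $\mathbb{Z}[x_1,\ldots,x_n]$ generated by $\mathfrak{C}_h=\{e_{h_i-r}(1,\ldots,h_i): 1\le i\le n,\ 0\le r\le i-1\}$. *)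

theory Defs
  imports "HOL-Library.Poly_Mapping" "HOL-Algebra.Ideal"
begin

text \<open>
  An integer polynomial in variables indexed by the natural numbers is a finitely supported map
  from monomials (finitely supported exponent functions) to coefficients; the multiplication of
  \<^typ>\<open>(nat \<Rightarrow>\<^sub>0 nat) \<Rightarrow>\<^sub>0 int\<close> is convolution, i.e. polynomial multiplication.
\<close>

type_synonym zpoly = "(nat \<Rightarrow>\<^sub>0 nat) \<Rightarrow>\<^sub>0 int"

definition pvar :: "nat \<Rightarrow> zpoly" where
  "pvar i = Poly_Mapping.single (Poly_Mapping.single i 1) 1"

text \<open>The ring of integer polynomials in which only the variables 1, ..., n occur.\<close>

definition poly_ring :: "nat \<Rightarrow> zpoly ring" where
  "poly_ring n =
     \<lparr>carrier = {p. \<forall>m \<in> Poly_Mapping.keys p. Poly_Mapping.keys m \<subseteq> {1..n}},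
      mult = (*), one = 1, zero = 0, add = (+)\<rparr>"

text \<open>
  The degree is an integer, so that degrees below 0 or above the size of the finite set \<open>S\<close>
  give the empty sum.
\<close>

definition esym :: "int \<Rightarrow> nat set \<Rightarrow> zpoly" where
  "esym d S = (\<Sum>A | A \<subseteq> S \<and> int (card A) = d. \<Prod>i\<in>A. pvar i)"

text \<open>
  An n-tuple is represented by the values of a function at 1, ..., n; values elsewhere are
  irrelevant, and equality of tuples is equality at these arguments.
\<close>

definition hessenberg :: "nat \<Rightarrow> (nat \<Rightarrow> nat) \<Rightarrow> bool" where
  "hessenberg n h \<longleftrightarrow>
     (\<forall>i \<in> {1..n}. i \<le> h i \<and> h i \<le> n) \<and>
     (\<forall>i. 1 \<le> i \<and> i < n \<longrightarrow> h i \<le> h (i + 1))"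

definition hess_le :: "nat \<Rightarrow> (nat \<Rightarrow> nat) \<Rightarrow> (nat \<Rightarrow> nat) \<Rightarrow> bool" where
  "hess_le n h h' \<longleftrightarrow> (\<forall>i \<in> {1..n}. h i \<le> h' i)"

definition hess_less :: "nat \<Rightarrow> (nat \<Rightarrow> nat) \<Rightarrow> (nat \<Rightarrow> nat) \<Rightarrow> bool" where
  "hess_less n h h' \<longleftrightarrow> hess_le n h h' \<and> (\<exists>i \<in> {1..n}. h i \<noteq> h' i)"

definition hess_gens :: "nat \<Rightarrow> (nat \<Rightarrow> nat) \<Rightarrow> zpoly set" where
  "hess_gens n h =
     {esym (int (h i) - int r) {1..h i} | i r. 1 \<le> i \<and> i \<le> n \<and> r \<le> i - 1}"

definition hess_ideal :: "nat \<Rightarrow> (nat \<Rightarrow> nat) \<Rightarrow> zpoly set" where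
  "hess_ideal n h = genideal (poly_ring n) (hess_gens n h)"

lemma poly_ring_simps:
  "p \<in> carrier (poly_ring n) \<longleftrightarrow>
     (\<forall>m \<in> Poly_Mapping.keys p. Poly_Mapping.keys m \<subseteq> {1..n})"
  "mult (poly_ring n) = (*)" "one (poly_ring n) = 1"
  "zero (poly_ring n) = 0" "add (poly_ring n) = (+)"
  by (simp_all add: poly_ring_def)

lemma poly_ring_add_closed:
  "p \<in> carrier (poly_ring n) \<Longrightarrow> q \<in> carrier (poly_ring n) \<Longrightarrow> p + q \<in> carrier (poly_ring n)"
  using Poly_Mapping.keys_add[of p q] by (fastforce simp: poly_ring_simps)

lemma poly_ring_uminus_closed:
  "p \<in> carrier (poly_ring n) \<Longrightarrow> - p \<in> carrier (poly_ring n)"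
  by (simp add: poly_ring_simps Poly_Mapping.keys_minus)

lemma poly_ring_mult_closed:
  assumes "p \<in> carrier (poly_ring n)" "q \<in> carrier (poly_ring n)"
  shows "p * q \<in> carrier (poly_ring n)"
proof -
  have "Poly_Mapping.keys m \<subseteq> {1..n}" if mem: "m \<in> Poly_Mapping.keys (p * q)" for m
  proof -
    obtain a b where ab: "m = a + b" "a \<in> Poly_Mapping.keys p" "b \<in> Poly_Mapping.keys q"
      using mem Poly_Mapping.keys_mult[of p q] by blast
    then have "Poly_Mapping.keys a \<subseteq> {1..n}" "Poly_Mapping.keys b \<subseteq> {1..n}"
      using assms by (auto simp: poly_ring_simps)
    then show ?thesis
      using Poly_Mapping.keys_add[of a b] ab(1) by blast
  qed
  then show ?thesis by (simp add: poly_ring_simps)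
qed

lemma poly_ring_zero_one_closed:
  "0 \<in> carrier (poly_ring n)" "1 \<in> carrier (poly_ring n)"
  by (simp_all add: poly_ring_simps)

lemma cring_poly_ring: "cring (poly_ring n)"
proof (rule cringI)
  show "abelian_group (poly_ring n)"
  proof (rule abelian_groupI)
    fix x assume "x \<in> carrier (poly_ring n)"
    then show "\<exists>y\<in>carrier (poly_ring n). y \<oplus>\<^bsub>poly_ring n\<^esub> x = \<zero>\<^bsub>poly_ring n\<^esub>"
      by (intro bexI[of _ "- x"]) (simp_all add: poly_ring_simps(4,5) poly_ring_uminus_closed)
  qed (simp_all add: poly_ring_simps(2-5) poly_ring_add_closed poly_ring_zero_one_closed
        add.assoc add.commute)
  show "comm_monoid (poly_ring n)"
    by (rule comm_monoidI)
      (simp_all add: poly_ring_simps(2-5) poly_ring_mult_closed poly_ring_zero_one_closed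
        mult.assoc mult.commute)
qed (simp add: poly_ring_simps(2-5) distrib_right)

lemma pvar_closed: "1 \<le> i \<Longrightarrow> i \<le> n \<Longrightarrow> pvar i \<in> carrier (poly_ring n)"
  by (simp add: poly_ring_simps pvar_def)

lemma poly_ring_sum_closed:
  "(\<And>a. a \<in> A \<Longrightarrow> f a \<in> carrier (poly_ring n)) \<Longrightarrow> sum f A \<in> carrier (poly_ring n)"
  by (induction A rule: infinite_finite_induct)
    (simp_all add: poly_ring_zero_one_closed poly_ring_add_closed)

lemma poly_ring_prod_closed:
  "(\<And>a. a \<in> A \<Longrightarrow> f a \<in> carrier (poly_ring n)) \<Longrightarrow> prod f A \<in> carrier (poly_ring n)"
  by (induction A rule: infinite_finite_induct)
    (simp_all add: poly_ring_zero_one_closed poly_ring_mult_closed)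

lemma esym_closed: "S \<subseteq> {1..n} \<Longrightarrow> esym d S \<in> carrier (poly_ring n)"
  unfolding esym_def
  by (intro poly_ring_sum_closed poly_ring_prod_closed pvar_closed) auto

lemma hess_gens_closed: "hessenberg n h \<Longrightarrow> hess_gens n h \<subseteq> carrier (poly_ring n)"
  unfolding hess_gens_def hessenberg_def 
  by (fastforce intro!: esym_closed intro: order_trans)

lemma hess_ideal_ideal: "hessenberg n h \<Longrightarrow> ideal (hess_ideal n h) (poly_ring n)"
  unfolding hess_ideal_def
  by (intro ring.genideal_ideal hess_gens_closed cring.axioms(1) cring_poly_ring)

end

theory Submission
  imports Defs
begin

text \<open>
  The generators attached to the index $i$ are the $e_{h_i-r}(1,\dots,h_i)$ with $r < i$, so what
  is kept fixed along a change of $h$ is the codegree $r$, not the degree. In terms of codegrees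
  Pascal's rule reads
  $e_{|S|+1-r}(S \cup \{a\}) = e_{|S|-(r-1)}(S) + x_a\, e_{|S|-r}(S)$, and its first term vanishes
  for $r = 0$. Hence an ideal that contains $e_{|S|-s}(S)$ for all $s \le r$ also contains
  $e_{|T|-r}(T)$ for every finite $T \supseteq S$; take $S = \{1,\dots,h'_i\}$ and
  $T = \{1,\dots,h_i\}$.
\<close>

lemma sum_Pow_insert:
  fixes f :: "'a set \<Rightarrow> 'b::comm_monoid_add"
  assumes "finite S" and "a \<notin> S"
  shows "sum f (Pow (insert a S)) = sum f (Pow S) + (\<Sum>A\<in>Pow S. f (insert a A))"
proof -
  have "inj_on (insert a) (Pow S)"
    using assms(2) by (auto intro!: inj_onI)
  moreover have "Pow S \<inter> insert a ` Pow S = {}"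
    using assms(2) by auto
  ultimately show ?thesis
    using assms(1) by (simp add: Pow_insert sum.union_disjoint sum.reindex)
qed

lemma esym_eq_sum_Pow:
  assumes "finite S"
  shows "esym d S = (\<Sum>A\<in>Pow S. if int (card A) = d then \<Prod>i\<in>A. pvar i else 0)"
  using assms by (simp add: esym_def flip: sum.inter_filter)

lemma esym_insert:
  assumes "finite S" and "a \<notin> S"
  shows "esym d (insert a S) = esym d S + pvar a * esym (d - 1) S"
proof -
  let ?term = "\<lambda>d A. if int (card A) = d then \<Prod>i\<in>A. pvar i else 0"
  have "?term d (insert a A) = pvar a * ?term (d - 1) A" if "A \<in> Pow S" for A
  proof -
    have "finite A" and "a \<notin> A"
      using that assms finite_subset by auto
    then show ?thesis by auto
  qed
  then have "(\<Sum>A\<in>Pow S. ?term d (insert a A)) = pvar a * (\<Sum>A\<in>Pow S. ?term (d - 1) A)"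
    by (simp add: sum_distrib_left)
  then show ?thesis
    using assms by (simp add: esym_eq_sum_Pow sum_Pow_insert)
qed

lemma esym_eq_0_if_card_less:
  assumes "finite S" and "int (card S) < d"
  shows "esym d S = 0"
proof -
  have "int (card A) \<noteq> d" if "A \<in> Pow S" for A
    using that assms card_mono[of S A] by auto
  then show ?thesis
    using assms(1) by (simp add: esym_eq_sum_Pow)
qed

definition esym_codegree :: "nat \<Rightarrow> nat set \<Rightarrow> zpoly" where
  "esym_codegree r S = esym (int (card S) - int r) S"

lemma esym_codegree_0_insert:
  assumes "finite S" and "a \<notin> S"
  shows "esym_codegree 0 (insert a S) = pvar a * esym_codegree 0 S"
  using assms by (simp add: esym_codegree_def esym_insert esym_eq_0_if_card_less)

lemma esym_codegree_Suc_insert: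
  assumes "finite S" and "a \<notin> S"
  shows "esym_codegree (Suc r) (insert a S) = esym_codegree r S + pvar a * esym_codegree (Suc r) S"
  using assms by (simp add: esym_codegree_def esym_insert algebra_simps)

lemma esym_codegree_insert_mem_ideal:
  assumes "ideal I (poly_ring n)" and "finite S" and "a \<in> {1..n}"
    and mem: "\<And>s. s \<le> r \<Longrightarrow> esym_codegree s S \<in> I"
  shows "esym_codegree r (insert a S) \<in> I"
proof (cases "a \<in> S")
  case True
  then show ?thesis using mem[of r] by (simp add: insert_absorb)
next
  case False
  interpret ideal I "poly_ring n" by fact
  have pvar_mult: "pvar a * esym_codegree r S \<in> I"
    using I_l_closed[OF mem[of r] pvar_closed] assms(3) by (simp add: poly_ring_simps(2))
  show ?thesis
  proof (cases r)
    case 0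
    then show ?thesis
      using pvar_mult assms(2) False by (simp add: esym_codegree_0_insert)
  next
    case (Suc s)
    then show ?thesis
      using additive_subgroup.a_closed[OF is_additive_subgroup mem[of s] pvar_mult] assms(2) False
      by (simp add: esym_codegree_Suc_insert poly_ring_simps(5))
  qed
qed

lemma esym_codegree_Un_mem_ideal:
  assumes "ideal I (poly_ring n)" and "finite S" and "U \<subseteq> {1..n}"
    and "\<And>s. s \<le> r \<Longrightarrow> esym_codegree s S \<in> I"
  shows "esym_codegree r (S \<union> U) \<in> I"
proof -
  have "finite U" using assms(3) finite_subset by blast
  then show ?thesis using assms(3,4)
  proof (induction U arbitrary: r rule: finite_induct)
    case empty
    then show ?case by simp
  next
    case (insert a U)
    have "esym_codegree s (S \<union> U) \<in> I" if "s \<le> r" for s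
      using insert.IH[of s] insert.prems that by simp
    then have "esym_codegree r (insert a (S \<union> U)) \<in> I"
      using assms(1,2) insert.hyps(1) insert.prems(1)
      by (intro esym_codegree_insert_mem_ideal) auto
    then show ?case by simp
  qed
qed

lemma hess_gens_eq_esym_codegree:
  "hess_gens n h = {esym_codegree r {1..h i} | i r. i \<in> {1..n} \<and> r < i}"
  unfolding hess_gens_def esym_codegree_def by (fastforce simp: less_eq_Suc_le)

lemma hess_gens_subset_hess_ideal:
  assumes "hessenberg n h"
  shows "hess_gens n h \<subseteq> hess_ideal n h"
  unfolding hess_ideal_def
  by (rule ring.genideal_self[OF cring.axioms(1)[OF cring_poly_ring] hess_gens_closed[OF assms]])

lemma hess_ideal_minimal:
  assumes "ideal I (poly_ring n)" and "hess_gens n h \<subseteq> I"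
  shows "hess_ideal n h \<subseteq> I"
  unfolding hess_ideal_def
  using ring.genideal_minimal[OF cring.axioms(1)[OF cring_poly_ring]] assms .

theorem theorem4p8:
  fixes n :: nat and h h' :: "nat \<Rightarrow> nat"
  assumes "hessenberg n h" and "hessenberg n h'"
    and "hess_less n h' h"
  shows "hess_ideal n h \<subseteq> hess_ideal n h'"
proof (rule hess_ideal_minimal)
  show ideal: "ideal (hess_ideal n h') (poly_ring n)"
    using assms(2) by (rule hess_ideal_ideal)
  show "hess_gens n h \<subseteq> hess_ideal n h'"
  proof
    fix p assume "p \<in> hess_gens n h"
    then obtain i r where i: "i \<in> {1..n}" and "r < i" and p: "p = esym_codegree r {1..h i}"
      unfolding hess_gens_eq_esym_codegree by blast
    have "esym_codegree s {1..h' i} \<in> hess_ideal n h'" if "s \<le> r" for s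
      using hess_gens_subset_hess_ideal[OF assms(2)] i \<open>r < i\<close> that
      unfolding hess_gens_eq_esym_codegree by fastforce
    moreover have "h' i \<le> h i" and "h i \<le> n"
      using assms i by (auto simp: hess_less_def hess_le_def hessenberg_def)
    ultimately have "esym_codegree r ({1..h' i} \<union> {1..h i}) \<in> hess_ideal n h'"
      by (intro esym_codegree_Un_mem_ideal[OF ideal]) auto
    then show "p \<in> hess_ideal n h'"
      using \<open>h' i \<le> h i\<close> by (simp add: p Un_absorb1)
  qed
qed

end
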